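(* Let $(S,+,0,\bullet,1)$ be a partial commutative semiring satisfying the standing assumptions below, let $FX=\coprod_{\lambda\in\Lambda}X^{\mathrm{ar}(\lambda)}$ and let $(C,\gamma)$ be a $\mathsf{T}_S\circ F$-coalgebra. If $c,d\in C$ satisfy $\mathsf{lt}_\gamma(c,b)=\mathsf{lt}_\gamma(d,b)$ for all trace fragments $b$ (linear time equivalence), then $\mathsf{tr}_\gamma(c,z)=\mathsf{tr}_\gamma(d,z)$ for all maximal traces $z$ (maximal trace equivalence).
   Context: A partial commutative semiring is a tuple $(S,+,0,\bullet,1)$ where $+$ is a partial binary operation on $S$, commutative and associative whenever defined, with unit $0$; $(S,\bullet,1)$ is a commutative monoid; $s\bullet 0=0$; and whenever $t+u$ is defined, $s\bullet t+s\bullet u$ is defined and equals $s\bullet(t+u)$. Define $x\sqsubseteq y$ iff $x+z=y$ for some $z$. Standing assumptions: $\sqsubseteq$ is a partial order in which increasing $\omega$-chains have suprema and decreasing $\omega$-chains have infima, $1$ is the top element, $+$ and $\bullet$ preserve suprema of increasing and infima of decreasing $\omega$-chains in each argument; and $(S,\sqsubseteq)$ is a complete lattice. $\mathsf{T}_SX$ is the set of finitely supported $\varphi:X\to S$ whose sum of values is defined; $\Lambda$ is a set of symbols with arities $\mathrm{ar}(\lambda)\in\mathbb N$, elements of $FX$ are written $\iota_\lambda(x_1,\dots,x_{\mathrm{ar}(\lambda)})$, and a $\mathsf{T}_S\circ F$-coalgebra is a map $\gamma:C\to\mathsf{T}_S(FC)$. Empty products in $S$ are $1$; functions into $S$ are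 ordered pointwise. The $\nu$-extent $\mathsf{ext}_\gamma:C\to S$ is the greatest fixpoint of the operator on $S^C$ sending $p$ to $c\mapsto\sum_{\lambda}\sum_{(c_1,\dots,c_n),\,n=\mathrm{ar}(\lambda)}\gamma(c)(\iota_\lambda(c_1,\dots,c_n))\bullet p(c_1)\bullet\cdots\bullet p(c_n)$. Trace fragments: finite ordered trees whose nodes are labelled either by $\lambda\in\Lambda$ with exactly $\mathrm{ar}(\lambda)$ children, or by a special leaf symbol $[]$. The linear time behaviour $\mathsf{lt}_\gamma$ is the greatest fixpoint of the operator sending $R:C\times B\to S$ ($B$ the trace fragments) to $(c,[])\mapsto\mathsf{ext}_\gamma(c)$, $(c,\lambda(b_1,\dots,b_n))\mapsto\sum_{(c_1,\dots,c_n)}\gamma(c)(\iota_\lambda(c_1,\dots,c_n))\bullet R(c_1,b_1)\bullet\cdots\bullet R(c_n,b_n)$. Maximal traces: $Z$ is the set of possibly infinite ordered trees whose nodes are labelled by $\lambda\in\Lambda$ with exactly $\mathrm{ar}(\lambda)$ children (the final $F$-coalgebra). The maximal trace behaviour $\mathsf{tr}_\gamma:C\times Z\to S$ is the greatest fixpoint of the operator sending $R:C\times Z\to S$ to $(c,z)\mapsto\sum_{(c_1,\dots,c_n)}\gamma(c)(\iota_\lambda(c_1,\dots,c_n))\bullet R(c_1,z_1)\bullet\cdots\bullet R(c_n,z_n)$, where $z$ has root label $\lambda$ and child subtrees $z_1,\dots,z_n$. *)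

theory Defs
  imports Main
begin

text \<open>
  The partial addition is option-valued. Associativity and commutativity are Kleene equalities:
  one side is defined iff the other one is, and then they agree.
\<close>

class partial_comm_semiring = comm_monoid_mult + mult_zero +
  fixes padd :: "'a \<Rightarrow> 'a \<Rightarrow> 'a option"
  assumes padd_assoc:
    "Option.bind (padd x y) (\<lambda>u. padd u z) = Option.bind (padd y z) (\<lambda>v. padd x v)"
    and padd_commute: "padd x y = padd y x"
    and padd_zero: "padd x 0 = Some x"
    and mult_padd: "padd t u = Some v \<Longrightarrow> padd (s * t) (s * u) = Some (s * v)"
begin

definition lift_padd :: "'a option \<Rightarrow> 'a option \<Rightarrow> 'a option"
  where "lift_padd u v = Option.bind u (\<lambda>x. Option.bind v (\<lambda>y. padd x y))"

text \<open>
  \<open>psum f I\<close> is the sum of the family \<open>f\<close> over \<open>I\<close>, computed over the (finite) set of those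
  \<open>i \<in> I\<close> with \<open>f i \<noteq> Some 0\<close>; it is \<open>None\<close> if the sum is undefined. The library's convention
  for infinite supports (value \<open>Some 0\<close>) is never relevant below, since all families that are
  summed are supported within the finite support of some element of \<open>T_S\<close>.
\<close>

sublocale psum: comm_monoid_set lift_padd "Some 0"
  defines psum_fin = psum.F and psum = psum.G
proof
  fix a b c :: "'a option"
  show "lift_padd (lift_padd a b) c = lift_padd a (lift_padd b c)"
    using padd_assoc by (cases a; cases b; cases c) (auto simp: lift_padd_def)
  show "lift_padd a b = lift_padd b a"
    using padd_commute by (cases a; cases b) (auto simp: lift_padd_def)
  show "lift_padd a (Some 0) = a"
    by (cases a) (auto simp: lift_padd_def padd_zero)
qed

end

text \<open>
  The order of the complete lattice is the one induced by the partial addition. By commutativity,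
  preservation of suprema and infima in one argument gives preservation in each argument.
  Addition preserves the supremum (infimum) of a chain \<open>x\<close> if, whenever all \<open>x i + y\<close> are defined,
  so is the sum of the supremum (infimum) with \<open>y\<close>, and it is the supremum (infimum) of the
  \<open>x i + y\<close>.
\<close>

class continuous_partial_comm_semiring = partial_comm_semiring + complete_lattice +
  assumes le_iff_padd: "x \<le> y \<longleftrightarrow> (\<exists>z. padd x z = Some y)"
    and one_eq_top: "1 = top"
    and padd_Sup_chain:
      "\<lbrakk>\<forall>i::nat. xs i \<le> xs (Suc i); \<forall>i. padd (xs i) y = Some (w i)\<rbrakk>
        \<Longrightarrow> padd (Sup (range xs)) y = Some (Sup (range w))"
    and padd_Inf_chain:
      "\<lbrakk>\<forall>i::nat. xs (Suc i) \<le> xs i; \<forall>i. padd (xs i) y = Some (w i)\<rbrakk>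
        \<Longrightarrow> padd (Inf (range xs)) y = Some (Inf (range w))"
    and mult_Sup_chain:
      "\<forall>i::nat. xs i \<le> xs (Suc i) \<Longrightarrow> Sup (range xs) * y = Sup (range (\<lambda>i. xs i * y))"
    and mult_Inf_chain:
      "\<forall>i::nat. xs (Suc i) \<le> xs i \<Longrightarrow> Inf (range xs) * y = Inf (range (\<lambda>i. xs i * y))"

text \<open>
  A map \<open>X \<rightarrow> S\<close> on a subset \<open>X\<close> of a type is represented by its extension by \<open>0\<close>.
\<close>

definition T_S :: "'x set \<Rightarrow> ('x \<Rightarrow> 's::partial_comm_semiring) set"
  where "T_S X = {\<phi>. {x. \<phi> x \<noteq> 0} \<subseteq> X \<and> finite {x. \<phi> x \<noteq> 0} \<and> psum (\<lambda>x. Some (\<phi> x)) X \<noteq> None}"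

text \<open>The pair \<open>(l, [x\<^sub>1, \<dots>, x\<^sub>n])\<close> represents \<open>\<iota>\<^sub>l(x\<^sub>1, \<dots>, x\<^sub>n)\<close>.\<close>

definition Fset :: "('l \<Rightarrow> nat) \<Rightarrow> 'x set \<Rightarrow> ('l \<times> 'x list) set"
  where "Fset ar X = {(l, xs). length xs = ar l \<and> set xs \<subseteq> X}"

definition coalgebra ::
    "('l \<Rightarrow> nat) \<Rightarrow> ('c \<Rightarrow> 'l \<times> 'c list \<Rightarrow> 's::partial_comm_semiring) \<Rightarrow> bool"
  where "coalgebra ar \<gamma> \<longleftrightarrow> (\<forall>c. \<gamma> c \<in> T_S (Fset ar UNIV))"

text \<open>
  For a coalgebra and functions into a semiring with top element \<open>1\<close>, the sums in the following
  operators are always defined, so that \<open>the\<close> is never applied to \<open>None\<close>.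
\<close>

definition ext_op ::
    "('l \<Rightarrow> nat) \<Rightarrow> ('c \<Rightarrow> 'l \<times> 'c list \<Rightarrow> 's::continuous_partial_comm_semiring)
      \<Rightarrow> ('c \<Rightarrow> 's) \<Rightarrow> 'c \<Rightarrow> 's"
  where "ext_op ar \<gamma> p c =
    the (psum (\<lambda>l. psum (\<lambda>cs. Some (\<gamma> c (l, cs) * prod_list (map p cs))) {cs. length cs = ar l}) UNIV)"

definition ext ::
    "('l \<Rightarrow> nat) \<Rightarrow> ('c \<Rightarrow> 'l \<times> 'c list \<Rightarrow> 's::continuous_partial_comm_semiring) \<Rightarrow> 'c \<Rightarrow> 's"
  where "ext ar \<gamma> = gfp (ext_op ar \<gamma>)"

datatype 'l fragment = Hole | Node 'l "'l fragment list"

fun trace_fragment :: "('l \<Rightarrow> nat) \<Rightarrow> 'l fragment \<Rightarrow> bool"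
  where
    "trace_fragment ar Hole = True"
  | "trace_fragment ar (Node l bs) = (length bs = ar l \<and> (\<forall>b\<in>set bs. trace_fragment ar b))"

text \<open>
  The operators below act on functions that are defined on all trees, including those which violate
  the arities. The value of such an operator at a tree that respects the arities only depends on
  the values of its argument at such trees, so the greatest fixpoint restricts to the greatest
  fixpoint for the trees that respect the arities.
\<close>

definition lt_op ::
    "('l \<Rightarrow> nat) \<Rightarrow> ('c \<Rightarrow> 'l \<times> 'c list \<Rightarrow> 's::continuous_partial_comm_semiring)
      \<Rightarrow> ('c \<Rightarrow> 'l fragment \<Rightarrow> 's) \<Rightarrow> 'c \<Rightarrow> 'l fragment \<Rightarrow> 's"
  where "lt_op ar \<gamma> R c b =
    (case b of
      Hole \<Rightarrow> ext ar \<gamma> c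
    | Node l bs \<Rightarrow>
        the (psum (\<lambda>cs. Some (\<gamma> c (l, cs) * prod_list (map2 R cs bs))) {cs. length cs = ar l}))"

definition lt ::
    "('l \<Rightarrow> nat) \<Rightarrow> ('c \<Rightarrow> 'l \<times> 'c list \<Rightarrow> 's::continuous_partial_comm_semiring)
      \<Rightarrow> 'c \<Rightarrow> 'l fragment \<Rightarrow> 's"
  where "lt ar \<gamma> = gfp (lt_op ar \<gamma>)"

codatatype 'l mtree = MNode (root: 'l) (children: "'l mtree list")

coinductive maximal_trace :: "('l \<Rightarrow> nat) \<Rightarrow> 'l mtree \<Rightarrow> bool" for ar
  where
    "\<lbrakk>length zs = ar l; \<forall>z\<in>set zs. maximal_trace ar z\<rbrakk> \<Longrightarrow> maximal_trace ar (MNode l zs)"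

definition tr_op ::
    "('l \<Rightarrow> nat) \<Rightarrow> ('c \<Rightarrow> 'l \<times> 'c list \<Rightarrow> 's::continuous_partial_comm_semiring)
      \<Rightarrow> ('c \<Rightarrow> 'l mtree \<Rightarrow> 's) \<Rightarrow> 'c \<Rightarrow> 'l mtree \<Rightarrow> 's"
  where "tr_op ar \<gamma> R c z =
    the (psum (\<lambda>cs. Some (\<gamma> c (root z, cs) * prod_list (map2 R cs (children z))))
      {cs. length cs = ar (root z)})"

definition tr ::
    "('l \<Rightarrow> nat) \<Rightarrow> ('c \<Rightarrow> 'l \<times> 'c list \<Rightarrow> 's::continuous_partial_comm_semiring)
      \<Rightarrow> 'c \<Rightarrow> 'l mtree \<Rightarrow> 's"
  where "tr ar \<gamma> = gfp (tr_op ar \<gamma>)"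

end

theory Submission
  imports Defs "HOL.Topological_Spaces"
begin

text \<open>
  The behaviour at a maximal trace is the infimum of the linear time behaviours at its finite
  truncations, \<open>tr c z = (INF n. lt c (truncate n z))\<close>, so the former is determined by the latter.
  For \<open>\<le>\<close>, the function \<open>c \<mapsto> (SUP z. tr c z)\<close> is a post-fixpoint of the extent operator, so that
  \<open>tr c z\<close> lies below the extent of \<open>c\<close>, which is the value at the truncation of depth \<open>0\<close>; one then
  inducts on the depth. For \<open>\<ge>\<close>, the infima form a post-fixpoint of the trace operator, because they
  are infima of decreasing chains, with which finite sums and products commute.
\<close>

section \<open>Order and finite sums\<close>

lemma zero_least: "0 \<le> (x :: 's::continuous_partial_comm_semiring)"
  using le_iff_padd padd_commute padd_zero by metis

text \<open>Definedness passes downwards: if \<open>u + a' = a\<close> and \<open>a + b\<close> is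
  defined, Kleene associativity regroups the sum as \<open>u + (a' + b)\<close>, so
  \<open>a' + b\<close> is defined and \<open>u\<close> witnesses the inequality.\<close>

lemma padd_mono:
  fixes x y :: "'s::continuous_partial_comm_semiring"
  assumes "padd x y = Some w" "x' \<le> x" "y' \<le> y"
  shows "\<exists>w'. padd x' y' = Some w' \<and> w' \<le> w"
proof -
  have left: "\<exists>w'. padd a' b = Some w' \<and> w' \<le> w" if ab: "padd a b = Some w" "a' \<le> a"
    for a a' b w :: 's
  proof -
    obtain u where u: "padd u a' = Some a"
      using ab(2) le_iff_padd padd_commute by metis
    have "Option.bind (padd a' b) (padd u) = Some w"
      using padd_assoc[of u a' b] u ab(1) by simp
    then obtain v where v: "padd a' b = Some v" "padd u v = Some w"
      by (cases "padd a' b") auto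
    then have "v \<le> w" using le_iff_padd padd_commute by metis
    with v show ?thesis by blast
  qed
  obtain v where v: "padd x' y = Some v" "v \<le> w" using left assms by blast
  then obtain v' where "padd y' x' = Some v'" "v' \<le> v" using left assms(3) padd_commute by metis
  with v show ?thesis using padd_commute order_trans by metis
qed

text \<open>Distributivity turns a difference \<open>z\<close> between \<open>t\<close> and
  \<open>u\<close> into the difference \<open>s * z\<close> between the products.\<close>

lemma mult_mono_pcs:
  fixes x y :: "'s::continuous_partial_comm_semiring"
  assumes "x \<le> x'" "y \<le> y'"
  shows "x * y \<le> x' * y'"
proof -
  have left: "s * t \<le> s * u" if "t \<le> u" for s t u :: 's
    using that le_iff_padd mult_padd by metis
  have "x * y \<le> x * y'" using left assms by blast
  also have "\<dots> = y' * x" by (simp add: mult.commute)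
  also have "\<dots> \<le> y' * x'" using left assms by blast
  finally show ?thesis by (simp add: mult.commute)
qed

lemma mult_le_left:
  fixes x y :: "'s::continuous_partial_comm_semiring"
  shows "x * y \<le> x"
  using mult_mono_pcs[OF order_refl top_greatest, of x y] by (simp flip: one_eq_top)

lemma prod_list_map_mono:
  fixes f g :: "'a \<Rightarrow> 's::continuous_partial_comm_semiring"
  assumes "\<And>x. x \<in> set xs \<Longrightarrow> f x \<le> g x"
  shows "prod_list (map f xs) \<le> prod_list (map g xs)"
  using assms by (induction xs) (auto intro: mult_mono_pcs)

text \<open>The relational form carries definedness and value together, so that inductions on finite
  index sets need no case split on \<open>None\<close>.\<close>

definition has_psum :: "('a \<Rightarrow> 's::continuous_partial_comm_semiring) \<Rightarrow> 'a set \<Rightarrow> 's \<Rightarrow> bool"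
  where "has_psum f A s \<longleftrightarrow> psum_fin (\<lambda>x. Some (f x)) A = Some s"

lemma has_psum_unique: "has_psum f A s \<Longrightarrow> has_psum f A t \<Longrightarrow> s = t"
  by (simp add: has_psum_def)

lemma has_psum_empty [simp]: "has_psum f {} s \<longleftrightarrow> s = 0"
  by (auto simp: has_psum_def)

lemma has_psum_insert:
  assumes "finite A" "a \<notin> A"
  shows "has_psum f (insert a A) s \<longleftrightarrow> (\<exists>t. has_psum f A t \<and> padd (f a) t = Some s)"
  using assms
  by (cases "psum_fin (\<lambda>x. Some (f x)) A") (auto simp: has_psum_def lift_padd_def)

lemma has_psum_mono:
  assumes "finite A" "has_psum f A s" "\<And>x. x \<in> A \<Longrightarrow> g x \<le> f x"
  shows "\<exists>t. has_psum g A t \<and> t \<le> s"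
  using assms
proof (induction A arbitrary: s rule: finite_induct)
  case empty
  then show ?case by simp
next
  case (insert a A)
  obtain t where t: "has_psum f A t" "padd (f a) t = Some s"
    using insert.prems(1) insert.hyps by (auto simp: has_psum_insert)
  obtain t' where t': "has_psum g A t'" "t' \<le> t"
    using insert.IH[OF t(1)] insert.prems(2) by blast
  have "g a \<le> f a" using insert.prems(2) by simp
  then obtain s' where "padd (g a) t' = Some s'" "s' \<le> s"
    using padd_mono[OF t(2)] t'(2) by blast
  with t' show ?case using insert.hyps by (auto simp: has_psum_insert)
qed

text \<open>A subsum is the full sum of the family set to 0 outside \<open>B\<close>. As 0 is the
  least element, monotonicity gives both definedness and the bound.\<close>

lemma has_psum_subset:
  assumes "finite A" "has_psum f A s" "B \<subseteq> A"
  shows "\<exists>t. has_psum f B t \<and> t \<le> s"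
proof -
  have "psum_fin (\<lambda>x. Some (if x \<in> B then f x else 0)) A = psum_fin (\<lambda>x. Some (f x)) B"
    by (rule psum.mono_neutral_cong_right[OF assms(1,3)]) auto
  then show ?thesis
    using has_psum_mono[OF assms(1,2), of "\<lambda>x. if x \<in> B then f x else 0"]
    by (auto simp: has_psum_def zero_least)
qed

section \<open>Infima of decreasing chains\<close>

text \<open>The continuity axiom moves one argument at a time. Applying it twice yields a double
  infimum over the array of mixed sums, which collapses to its diagonal.\<close>

lemma padd_INF:
  fixes x y w :: "nat \<Rightarrow> 's::continuous_partial_comm_semiring"
  assumes x: "decseq x" and y: "decseq y" and w: "\<And>n. padd (x n) (y n) = Some (w n)"
  shows "padd (INF n. x n) (INF n. y n) = Some (INF n. w n)"
proof -
  \<comment> \<open>Every mixed sum is dominated summand by summand by the defined sum at index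
    0.\<close>
  have "\<exists>v. padd (x i) (y j) = Some v" for i j
    using padd_mono[OF w[of 0], of "x i" "y j"] x y by (auto simp: decseq_def)
  then obtain v where v: "\<And>i j. padd (x i) (y j) = Some (v i j)" by metis
  have vmono: "v i j \<le> v i' j'" if "i' \<le> i" "j' \<le> j" for i j i' j'
    using padd_mono[OF v[of i' j'], of "x i" "y j"] x y v that by (auto simp: decseq_def)
  have "padd (INF n. x n) (y j) = Some (INF i. v i j)" for j
    using x v by (intro padd_Inf_chain) (auto simp: decseq_Suc_iff)
  then have "padd (INF n. y n) (INF n. x n) = Some (INF j. INF i. v i j)"
    using y by (intro padd_Inf_chain) (auto simp: decseq_Suc_iff padd_commute)
  moreover have "(INF j. INF i. v i j) = (INF n. w n)"
  proof (rule antisym)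
    have "v n n = w n" for n using v[of n n] w[of n] by simp
    then show "(INF j. INF i. v i j) \<le> (INF n. w n)"
      by (intro INF_greatest) (metis INF_lower2 UNIV_I order_refl)
    \<comment> \<open>The diagonal entry at \<open>max i j\<close> lies below
      \<open>v i j\<close>.\<close>
    show "(INF n. w n) \<le> (INF j. INF i. v i j)"
      using \<open>\<And>n. v n n = w n\<close>
      by (intro INF_greatest) (metis INF_lower2 UNIV_I max.cobounded1 max.cobounded2 vmono)
  qed
  ultimately show ?thesis using padd_commute by metis
qed

lemma mult_INF:
  fixes x y :: "nat \<Rightarrow> 's::continuous_partial_comm_semiring"
  assumes x: "decseq x" and y: "decseq y"
  shows "(INF n. x n) * (INF n. y n) = (INF n. x n * y n)"
proof -
  have "(INF n. y n) * (INF n. x n) = (INF j. y j * (INF n. x n))"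
    using y by (intro mult_Inf_chain) (auto simp: decseq_Suc_iff)
  moreover have "y j * (INF n. x n) = (INF i. x i * y j)" for j
    using x mult_Inf_chain[of x "y j"] by (auto simp: decseq_Suc_iff mult.commute)
  moreover have "(INF j. INF i. x i * y j) = (INF n. x n * y n)"
  proof (rule antisym)
    show "(INF j. INF i. x i * y j) \<le> (INF n. x n * y n)"
      by (intro INF_greatest) (blast intro: INF_lower2)
    have "x (max i j) * y (max i j) \<le> x i * y j" for i j
      using x y by (intro mult_mono_pcs) (auto simp: decseq_def)
    then show "(INF n. x n * y n) \<le> (INF j. INF i. x i * y j)"
      by (intro INF_greatest) (rule INF_lower2[OF UNIV_I])
  qed
  ultimately show ?thesis by (simp add: mult.commute)
qed

lemma prod_list_map_INF:
  fixes f :: "nat \<Rightarrow> 'a \<Rightarrow> 's::continuous_partial_comm_semiring"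
  assumes "\<And>x. x \<in> set xs \<Longrightarrow> decseq (\<lambda>n. f n x)"
  shows "prod_list (map (\<lambda>x. INF n. f n x) xs) = (INF n. prod_list (map (f n) xs))"
  using assms
proof (induction xs)
  case (Cons a xs)
  have "decseq (\<lambda>n. prod_list (map (f n) xs))"
    using Cons.prems by (auto simp: decseq_def intro!: prod_list_map_mono)
  then show ?case using Cons mult_INF[of "\<lambda>n. f n a"] by simp
qed simp

lemma has_psum_INF:
  fixes f :: "nat \<Rightarrow> 'a \<Rightarrow> 's::continuous_partial_comm_semiring"
  assumes "finite A" "\<And>x. x \<in> A \<Longrightarrow> decseq (\<lambda>n. f n x)" "\<And>n. has_psum (f n) A (s n)"
  shows "has_psum (\<lambda>x. INF n. f n x) A (INF n. s n)"
  using assms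
proof (induction A arbitrary: s rule: finite_induct)
  case empty
  then show ?case by simp
next
  case (insert a A)
  have "\<forall>n. \<exists>t. has_psum (f n) A t \<and> padd (f n a) t = Some (s n)"
    using insert.prems(2) insert.hyps by (auto simp: has_psum_insert)
  then obtain t where t: "\<And>n. has_psum (f n) A (t n)" "\<And>n. padd (f n a) (t n) = Some (s n)"
    by metis
  \<comment> \<open>\<open>padd_INF\<close> needs the sums over \<open>A\<close> to form a
    decreasing chain too; monotonicity supplies a smaller sum and uniqueness identifies it with
    \<open>t n\<close>.\<close>
  have "decseq t"
    unfolding decseq_def
  proof (intro allI impI)
    fix m n :: nat assume "m \<le> n"
    then have "\<exists>u. has_psum (f n) A u \<and> u \<le> t m"
      using insert.prems(1) by (intro has_psum_mono[OF insert.hyps(1) t(1)]) (auto simp: decseq_def)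
    then show "t n \<le> t m" using t(1) has_psum_unique by metis
  qed
  then have "padd (INF n. f n a) (INF n. t n) = Some (INF n. s n)"
    using insert.prems(1) t(2) by (intro padd_INF) auto
  moreover have "has_psum (\<lambda>x. INF n. f n x) A (INF n. t n)"
    using insert.IH[of t] insert.prems(1) t(1) by auto
  ultimately show ?case using insert.hyps by (auto simp: has_psum_insert)
qed

section \<open>Sums over the successors in a coalgebra\<close>

text \<open>This is the common shape of the trace operator and of the node case of the linear time
  operator, with \<open>h\<close> standing for the product of the recursive values. Monotonicity and
  continuity are thus proved once for both.\<close>

definition succ_sum ::
    "('l \<Rightarrow> nat) \<Rightarrow> ('c \<Rightarrow> 'l \<times> 'c list \<Rightarrow> 's::continuous_partial_comm_semiring)
      \<Rightarrow> 'c \<Rightarrow> 'l \<Rightarrow> ('c list \<Rightarrow> 's) \<Rightarrow> 's"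
  where "succ_sum ar \<gamma> c l h = the (psum (\<lambda>cs. Some (\<gamma> c (l, cs) * h cs)) {cs. length cs = ar l})"

definition supp :: "('c \<Rightarrow> 'l \<times> 'c list \<Rightarrow> 's::partial_comm_semiring) \<Rightarrow> 'c \<Rightarrow> ('l \<times> 'c list) set"
  where "supp \<gamma> c = {x. \<gamma> c x \<noteq> 0}"

text \<open>The fibre of the support over a label: a finite index set replacing the possibly
  infinite set of all tuples of the right length.\<close>

definition supp_at :: "('c \<Rightarrow> 'l \<times> 'c list \<Rightarrow> 's::partial_comm_semiring) \<Rightarrow> 'c \<Rightarrow> 'l \<Rightarrow> 'c list set"
  where "supp_at \<gamma> c l = {cs. \<gamma> c (l, cs) \<noteq> 0}"

lemma psum_eq_psum_fin:
  fixes f :: "'a \<Rightarrow> 's::continuous_partial_comm_semiring option"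
  assumes "finite B" "B \<subseteq> A" "\<And>x. x \<in> A - B \<Longrightarrow> f x = Some 0"
  shows "psum f A = psum_fin f B"
proof -
  have "{x \<in> A. f x \<noteq> Some 0} \<subseteq> B" using assms(3) by blast
  then have "psum f A = psum_fin f {x \<in> A. f x \<noteq> Some 0}"
    using assms(1) by (simp add: psum.G_def finite_subset)
  also have "\<dots> = psum_fin f B"
    using assms by (intro psum.mono_neutral_left) auto
  finally show ?thesis .
qed

context
  fixes ar :: "'l \<Rightarrow> nat"
    and \<gamma> :: "'c \<Rightarrow> 'l \<times> 'c list \<Rightarrow> 's::continuous_partial_comm_semiring"
  assumes coalg: "coalgebra ar \<gamma>"
begin

lemma finite_supp: "finite (supp \<gamma> c)"
  using coalg by (auto simp: coalgebra_def T_S_def supp_def)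

lemma length_supp_at: "cs \<in> supp_at \<gamma> c l \<Longrightarrow> length cs = ar l"
  using coalg by (fastforce simp: coalgebra_def T_S_def supp_at_def Fset_def)

lemma finite_supp_at: "finite (supp_at \<gamma> c l)"
proof -
  have "supp_at \<gamma> c l = Pair l -` supp \<gamma> c" by (auto simp: supp_def supp_at_def)
  then show ?thesis by (simp add: finite_supp finite_vimageI inj_on_def)
qed

lemma supp_eq_Sigma: "supp \<gamma> c = Sigma (fst ` supp \<gamma> c) (supp_at \<gamma> c)"
  by (force simp: supp_def supp_at_def)

text \<open>The coefficients of \<open>\<gamma> c\<close> have a defined sum, and a factor can only
  decrease each of them because 1 is the top element. This is why \<open>the\<close> in the
  operators never meets \<open>None\<close>.\<close>

lemma has_psum_supp: "\<exists>s. has_psum (\<lambda>x. \<gamma> c x * h x) (supp \<gamma> c) s"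
proof -
  have "psum (\<lambda>x. Some (\<gamma> c x)) (Fset ar UNIV) \<noteq> None"
    using coalg by (auto simp: coalgebra_def T_S_def)
  moreover have "psum (\<lambda>x. Some (\<gamma> c x)) (Fset ar UNIV) = psum_fin (\<lambda>x. Some (\<gamma> c x)) (supp \<gamma> c)"
    using coalg by (intro psum_eq_psum_fin) (auto simp: coalgebra_def T_S_def supp_def)
  ultimately obtain s where "has_psum (\<gamma> c) (supp \<gamma> c) s"
    unfolding has_psum_def by auto
  from has_psum_mono[OF finite_supp this, of "\<lambda>x. \<gamma> c x * h x"] show ?thesis
    using mult_le_left by blast
qed

text \<open>The nested sum over labels and tuples is flattened to a single sum over the finite
  support, viewed as the disjoint union of its fibres.\<close>

lemma ext_op_has_psum:
  "has_psum (\<lambda>(l, cs). \<gamma> c (l, cs) * prod_list (map p cs)) (supp \<gamma> c) (ext_op ar \<gamma> p c)"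
proof -
  let ?f = "\<lambda>l cs. Some (\<gamma> c (l, cs) * prod_list (map p cs))"
  have inner: "psum (?f l) {cs. length cs = ar l} = psum_fin (?f l) (supp_at \<gamma> c l)" for l
    using length_supp_at by (intro psum_eq_psum_fin finite_supp_at) (auto simp: supp_at_def)
  \<comment> \<open>Labels outside the support contribute an empty sum, which cuts the outer sum
    down to finitely many labels.\<close>
  have "supp_at \<gamma> c l = {}" if "l \<notin> fst ` supp \<gamma> c" for l
    using that by (force simp: supp_def supp_at_def)
  then have "psum (\<lambda>l. psum (?f l) {cs. length cs = ar l}) UNIV
      = psum_fin (\<lambda>l. psum_fin (?f l) (supp_at \<gamma> c l)) (fst ` supp \<gamma> c)"
    unfolding inner by (intro psum_eq_psum_fin) (auto simp: finite_supp)
  also have "\<dots> = psum_fin (\<lambda>(l, cs). ?f l cs) (supp \<gamma> c)"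
    by (subst (2) supp_eq_Sigma, rule psum.Sigma) (auto simp: finite_supp finite_supp_at)
  finally show ?thesis
    using has_psum_supp[of c "\<lambda>(l, cs). prod_list (map p cs)"]
    by (auto simp: ext_op_def has_psum_def case_prod_unfold)
qed

text \<open>The injection \<open>Pair l\<close> embeds the fibre over \<open>l\<close> into the
  support, so the sum at one label is a subsum of the total: it is defined and lies below
  it.\<close>

lemma succ_sum_has_psum: "has_psum (\<lambda>cs. \<gamma> c (l, cs) * h cs) (supp_at \<gamma> c l) (succ_sum ar \<gamma> c l h)"
  and succ_sum_le_sum:
    "has_psum (\<lambda>(l, cs). \<gamma> c (l, cs) * h cs) (supp \<gamma> c) s \<Longrightarrow> succ_sum ar \<gamma> c l h \<le> s"
proof -
  let ?f = "\<lambda>cs. Some (\<gamma> c (l, cs) * h cs)"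
  have "psum ?f {cs. length cs = ar l} = psum_fin ?f (supp_at \<gamma> c l)"
    using length_supp_at by (intro psum_eq_psum_fin finite_supp_at) (auto simp: supp_at_def)
  moreover have reindex: "psum_fin (\<lambda>(l, cs). Some (\<gamma> c (l, cs) * h cs)) (Pair l ` supp_at \<gamma> c l)
      = psum_fin ?f (supp_at \<gamma> c l)"
    by (subst psum.reindex) (auto simp: inj_on_def o_def)
  moreover have "Pair l ` supp_at \<gamma> c l \<subseteq> supp \<gamma> c" by (auto simp: supp_def supp_at_def)
  note sub = has_psum_subset[OF finite_supp _ this, unfolded has_psum_def]
  ultimately have *: "psum_fin ?f (supp_at \<gamma> c l) = Some (succ_sum ar \<gamma> c l h) \<and> succ_sum ar \<gamma> c l h \<le> s"
    if "has_psum (\<lambda>(l, cs). \<gamma> c (l, cs) * h cs) (supp \<gamma> c) s" for s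
    using sub[of "\<lambda>(l, cs). \<gamma> c (l, cs) * h cs" s] that
    by (auto simp: has_psum_def succ_sum_def case_prod_unfold)
  from * show "has_psum (\<lambda>(l, cs). \<gamma> c (l, cs) * h cs) (supp \<gamma> c) s \<Longrightarrow> succ_sum ar \<gamma> c l h \<le> s"
    by blast
  \<comment> \<open>The total required by \<open>*\<close> exists by
    \<open>has_psum_supp\<close>.\<close>
  from * show "has_psum (\<lambda>cs. \<gamma> c (l, cs) * h cs) (supp_at \<gamma> c l) (succ_sum ar \<gamma> c l h)"
    using has_psum_supp[of c "\<lambda>(l, cs). h cs"] by (auto simp: has_psum_def case_prod_unfold)
qed

lemma succ_sum_le_ext_op: "succ_sum ar \<gamma> c l (\<lambda>cs. prod_list (map p cs)) \<le> ext_op ar \<gamma> p c"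
  by (rule succ_sum_le_sum[OF ext_op_has_psum])

lemma ext_op_mono: "mono (ext_op ar \<gamma>)"
proof (intro monoI le_funI)
  fix p q :: "'c \<Rightarrow> 's" and c assume "p \<le> q"
  then have "\<exists>t. has_psum (\<lambda>(l, cs). \<gamma> c (l, cs) * prod_list (map p cs)) (supp \<gamma> c) t
      \<and> t \<le> ext_op ar \<gamma> q c"
    by (intro has_psum_mono[OF finite_supp ext_op_has_psum])
      (auto simp: le_fun_def intro!: mult_mono_pcs prod_list_map_mono)
  then show "ext_op ar \<gamma> p c \<le> ext_op ar \<gamma> q c"
    using has_psum_unique[OF ext_op_has_psum] by blast
qed

lemma succ_sum_mono:
  assumes "\<And>cs. length cs = ar l \<Longrightarrow> h cs \<le> h' cs"
  shows "succ_sum ar \<gamma> c l h \<le> succ_sum ar \<gamma> c l h'"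
proof -
  have "\<exists>t. has_psum (\<lambda>cs. \<gamma> c (l, cs) * h cs) (supp_at \<gamma> c l) t \<and> t \<le> succ_sum ar \<gamma> c l h'"
    using assms length_supp_at
    by (intro has_psum_mono[OF finite_supp_at succ_sum_has_psum]) (auto intro!: mult_mono_pcs)
  then show ?thesis using has_psum_unique[OF succ_sum_has_psum] by blast
qed

lemma succ_sum_INF:
  assumes "\<And>cs. length cs = ar l \<Longrightarrow> decseq (\<lambda>n. h n cs)"
  shows "succ_sum ar \<gamma> c l (\<lambda>cs. INF n. h n cs) = (INF n. succ_sum ar \<gamma> c l (h n))"
proof -
  have dec: "decseq (\<lambda>n. h n cs)" if "cs \<in> supp_at \<gamma> c l" for cs
    using that assms length_supp_at by blast
  have "has_psum (\<lambda>cs. INF n. \<gamma> c (l, cs) * h n cs) (supp_at \<gamma> c l) (INF n. succ_sum ar \<gamma> c l (h n))"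
    using dec by (intro has_psum_INF finite_supp_at succ_sum_has_psum)
      (auto simp: decseq_def intro!: mult_mono_pcs)
  moreover have "(INF n. \<gamma> c (l, cs) * h n cs) = \<gamma> c (l, cs) * (INF n. h n cs)"
    if "cs \<in> supp_at \<gamma> c l" for cs
    \<comment> \<open>The coefficient is treated as a constant decreasing chain.\<close>
    using mult_INF[OF _ dec[OF that], of "\<lambda>_. \<gamma> c (l, cs)"] by (simp add: decseq_def)
  then have "has_psum (\<lambda>cs. INF n. \<gamma> c (l, cs) * h n cs) (supp_at \<gamma> c l)
      = has_psum (\<lambda>cs. \<gamma> c (l, cs) * (INF n. h n cs)) (supp_at \<gamma> c l)"
    by (auto simp: has_psum_def fun_eq_iff cong: psum.cong)
  ultimately show ?thesis
    using has_psum_unique[OF succ_sum_has_psum] by simp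
qed

section \<open>Fixpoint equations\<close>

lemma ext_unfold: "ext ar \<gamma> c = ext_op ar \<gamma> (ext ar \<gamma>) c"
  unfolding ext_def using gfp_unfold[OF ext_op_mono] by (rule fun_cong)

lemma lt_op_eq:
  "lt_op ar \<gamma> R c Hole = ext ar \<gamma> c"
  "lt_op ar \<gamma> R c (Node l bs) = succ_sum ar \<gamma> c l (\<lambda>cs. prod_list (map2 R cs bs))"
  by (simp_all add: lt_op_def succ_sum_def)

lemma lt_op_mono: "mono (lt_op ar \<gamma>)"
proof (intro monoI le_funI)
  fix R R' :: "'c \<Rightarrow> 'l fragment \<Rightarrow> 's" and c b assume "R \<le> R'"
  then show "lt_op ar \<gamma> R c b \<le> lt_op ar \<gamma> R' c b"
    by (cases b) (auto simp: lt_op_eq le_fun_def intro!: succ_sum_mono prod_list_map_mono)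
qed

lemma lt_Hole: "lt ar \<gamma> c Hole = ext ar \<gamma> c"
  and lt_Node: "lt ar \<gamma> c (Node l bs) = succ_sum ar \<gamma> c l (\<lambda>cs. prod_list (map2 (lt ar \<gamma>) cs bs))"
proof -
  have unfold: "lt ar \<gamma> = lt_op ar \<gamma> (lt ar \<gamma>)"
    unfolding lt_def by (rule gfp_unfold[OF lt_op_mono])
  show "lt ar \<gamma> c Hole = ext ar \<gamma> c"
    by (subst unfold) (rule lt_op_eq)
  show "lt ar \<gamma> c (Node l bs) = succ_sum ar \<gamma> c l (\<lambda>cs. prod_list (map2 (lt ar \<gamma>) cs bs))"
    by (subst unfold) (rule lt_op_eq)
qed

lemma tr_op_eq:
  "tr_op ar \<gamma> R c z = succ_sum ar \<gamma> c (root z) (\<lambda>cs. prod_list (map2 R cs (children z)))"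
  by (simp add: tr_op_def succ_sum_def)

lemma tr_op_mono: "mono (tr_op ar \<gamma>)"
  by (intro monoI le_funI)
    (auto simp: tr_op_eq le_fun_def intro!: succ_sum_mono prod_list_map_mono)

lemma tr_unfold:
  "tr ar \<gamma> c z = succ_sum ar \<gamma> c (root z) (\<lambda>cs. prod_list (map2 (tr ar \<gamma>) cs (children z)))"
proof -
  have "tr ar \<gamma> = tr_op ar \<gamma> (tr ar \<gamma>)"
    unfolding tr_def by (rule gfp_unfold[OF tr_op_mono])
  then show ?thesis by (subst tr_op_eq[symmetric]) (simp add: fun_eq_iff)
qed

end

section \<open>Approximation of maximal traces by truncations\<close>

lemma length_children: "maximal_trace ar z \<Longrightarrow> length (children z) = ar (root z)"
  by (auto elim: maximal_trace.cases)

lemma maximal_trace_zip_children: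
  "(c, z') \<in> set (zip cs (children z)) \<Longrightarrow> maximal_trace ar z \<Longrightarrow> maximal_trace ar z'"
  by (erule maximal_trace.cases) (auto dest: set_zip_rightD)

text \<open>Used once a bound no longer depends on the child trees: equal lengths ensure that
  \<open>zip\<close> drops none of the successor states.\<close>

lemma prod_list_map2_fst:
  fixes f :: "'a \<Rightarrow> 's::monoid_mult"
  shows "length xs = length ys \<Longrightarrow> prod_list (map2 (\<lambda>x y. f x) xs ys) = prod_list (map f xs)"
  by (induction xs ys rule: list_induct2) auto

primrec truncate :: "nat \<Rightarrow> 'l mtree \<Rightarrow> 'l fragment"
  where
    "truncate 0 z = Hole"
  | "truncate (Suc n) z = Node (root z) (map (truncate n) (children z))"

lemma trace_fragment_truncate: "maximal_trace ar z \<Longrightarrow> trace_fragment ar (truncate n z)"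
  by (induction n arbitrary: z) (auto elim: maximal_trace.cases)

context
  fixes ar :: "'l \<Rightarrow> nat"
    and \<gamma> :: "'c \<Rightarrow> 'l \<times> 'c list \<Rightarrow> 's::continuous_partial_comm_semiring"
  assumes coalg: "coalgebra ar \<gamma>"
begin

lemma tr_le_ext:
  assumes "maximal_trace ar z"
  shows "tr ar \<gamma> c z \<le> ext ar \<gamma> c"
proof -
  \<comment> \<open>The extent operator sees states only, so a bound independent of the tree is
    needed; completeness of the lattice provides this supremum. It ranges over arity-respecting
    trees, whose child lists are as long as the successor tuples.\<close>
  define p where "p c = (SUP z\<in>Collect (maximal_trace ar). tr ar \<gamma> c z)" for c
  have "tr ar \<gamma> c z \<le> ext_op ar \<gamma> p c" if z: "maximal_trace ar z" for c z
  proof -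
    have "tr ar \<gamma> c z
        \<le> succ_sum ar \<gamma> c (root z) (\<lambda>cs. prod_list (map2 (\<lambda>c z. p c) cs (children z)))"
      unfolding tr_unfold[OF coalg, of c z] p_def
      using z by (intro succ_sum_mono[OF coalg] prod_list_map_mono)
        (auto dest!: maximal_trace_zip_children intro!: SUP_upper)
    also have "\<dots> \<le> succ_sum ar \<gamma> c (root z) (\<lambda>cs. prod_list (map p cs))"
      using length_children[OF z] by (intro succ_sum_mono[OF coalg]) (simp add: prod_list_map2_fst)
    also have "\<dots> \<le> ext_op ar \<gamma> p c" by (rule succ_sum_le_ext_op[OF coalg])
    finally show ?thesis .
  qed
  then have "p \<le> ext_op ar \<gamma> p" by (auto simp: le_fun_def p_def[of _] intro!: SUP_least)
  then have "p \<le> ext ar \<gamma>" unfolding ext_def by (rule gfp_upperbound)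
  moreover have "tr ar \<gamma> c z \<le> p c" using assms by (auto simp: p_def intro: SUP_upper)
  ultimately show ?thesis by (auto simp: le_fun_def intro: order_trans)
qed

lemma lt_truncate_Suc:
  "lt ar \<gamma> c (truncate (Suc n) z) = succ_sum ar \<gamma> c (root z)
    (\<lambda>cs. prod_list (map2 (\<lambda>c z. lt ar \<gamma> c (truncate n z)) cs (children z)))"
  by (simp add: lt_Node[OF coalg] zip_map2 o_def case_prod_unfold)

lemma tr_le_lt_truncate:
  assumes "maximal_trace ar z"
  shows "tr ar \<gamma> c z \<le> lt ar \<gamma> c (truncate n z)"
  using assms
proof (induction n arbitrary: c z)
  case 0
  then show ?case by (simp add: lt_Hole[OF coalg] tr_le_ext)
next
  case (Suc n)
  then show ?case
    unfolding lt_truncate_Suc tr_unfold[OF coalg, of c z]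
    by (intro succ_sum_mono[OF coalg] prod_list_map_mono)
      (auto dest!: maximal_trace_zip_children)
qed

text \<open>Replacing the hole at the root by one layer of nodes with holes keeps the summands of a
  single label from the fixpoint sum of the extent, hence decreases the value. Monotonicity carries
  this through the layers above.\<close>

lemma lt_truncate_decseq:
  assumes "maximal_trace ar z"
  shows "decseq (\<lambda>n. lt ar \<gamma> c (truncate n z))"
  unfolding decseq_Suc_iff
proof
  fix n
  show "lt ar \<gamma> c (truncate (Suc n) z) \<le> lt ar \<gamma> c (truncate n z)"
    using assms
  proof (induction n arbitrary: c z)
    case 0
    have "lt ar \<gamma> c (truncate (Suc 0) z)
        \<le> succ_sum ar \<gamma> c (root z) (\<lambda>cs. prod_list (map (ext ar \<gamma>) cs))"
      unfolding lt_truncate_Suc using length_children[OF 0]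
      by (intro succ_sum_mono[OF coalg]) (simp add: lt_Hole[OF coalg] prod_list_map2_fst)
    also have "\<dots> \<le> ext ar \<gamma> c"
      using succ_sum_le_ext_op[OF coalg, of c "root z" "ext ar \<gamma>"]
      by (simp flip: ext_unfold[OF coalg])
    finally show ?case by (simp add: lt_Hole[OF coalg])
  next
    case (Suc n)
    then show ?case
      unfolding lt_truncate_Suc[of _ "Suc n"] lt_truncate_Suc[of c n z]
      by (intro succ_sum_mono[OF coalg] prod_list_map_mono)
        (auto simp del: truncate.simps dest!: maximal_trace_zip_children)
  qed
qed

lemma tr_eq_INF_lt_truncate:
  assumes "maximal_trace ar z"
  shows "tr ar \<gamma> c z = (INF n. lt ar \<gamma> c (truncate n z))"
proof (rule antisym)
  show "tr ar \<gamma> c z \<le> (INF n. lt ar \<gamma> c (truncate n z))"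
    using assms by (intro INF_greatest tr_le_lt_truncate)
  \<comment> \<open>The candidate must be a post-fixpoint on the whole tree type; the default 0
    makes this trivial at trees violating the arities.\<close>
  define R where "R c z = (if maximal_trace ar z then INF n. lt ar \<gamma> c (truncate n z) else 0)" for c z
  have "R c z \<le> tr_op ar \<gamma> R c z" for c z
  proof (cases "maximal_trace ar z")
    case z: True
    let ?h = "\<lambda>n cs. prod_list (map2 (\<lambda>c z. lt ar \<gamma> c (truncate n z)) cs (children z))"
    have dec: "decseq (\<lambda>n. (\<lambda>(c, z). lt ar \<gamma> c (truncate n z)) x)"
      if "x \<in> set (zip cs (children z))" for x and cs :: "'c list"
      using that maximal_trace_zip_children[OF _ z]
      by (cases x rule: prod.exhaust) (auto intro!: lt_truncate_decseq)
    \<comment> \<open>Dropping index 0 can only raise the infimum, and each remaining truncation has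
      a node at its root, so it unfolds to a sum over successors.\<close>
    have "R c z \<le> (INF n. lt ar \<gamma> c (truncate (Suc n) z))"
      using z by (auto simp: R_def simp del: truncate.simps intro!: INF_greatest INF_lower)
    also have "\<dots> = succ_sum ar \<gamma> c (root z) (\<lambda>cs. INF n. ?h n cs)"
      unfolding lt_truncate_Suc
      by (rule succ_sum_INF[OF coalg, symmetric])
        (use dec in \<open>auto simp: decseq_def intro!: prod_list_map_mono\<close>)
    \<comment> \<open>Having passed through the sum, the infimum now passes through the product; the
      children are again maximal traces, where \<open>R\<close> is the infimum and not the
      default.\<close>
    also have "(\<lambda>cs. INF n. ?h n cs) = (\<lambda>cs. prod_list (map2 R cs (children z)))"
    proof
      fix cs
      have "(INF n. ?h n cs)
          = prod_list (map (\<lambda>x. INF n. (\<lambda>(c, z). lt ar \<gamma> c (truncate n z)) x) (zip cs (children z)))"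
        using dec by (rule prod_list_map_INF[symmetric])
      also have "\<dots> = prod_list (map2 R cs (children z))"
        using z by (intro arg_cong[where f = prod_list] map_cong)
          (auto simp: R_def dest!: maximal_trace_zip_children)
      finally show "(INF n. ?h n cs) = prod_list (map2 R cs (children z))" .
    qed
    finally show ?thesis by (simp add: tr_op_eq[OF coalg])
  qed (simp add: R_def zero_least)
  then have "R \<le> tr ar \<gamma>" unfolding tr_def by (intro gfp_upperbound) (simp add: le_fun_def)
  then show "(INF n. lt ar \<gamma> c (truncate n z)) \<le> tr ar \<gamma> c z"
    using assms by (auto simp: le_fun_def R_def dest!: spec[of _ c] spec[of _ z])
qed

end

theorem theorem6p7:
  fixes ar :: "'l \<Rightarrow> nat"
    and \<gamma> :: "'c \<Rightarrow> 'l \<times> 'c list \<Rightarrow> 's::continuous_partial_comm_semiring"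
    and c d :: 'c
  assumes "coalgebra ar \<gamma>"
    and "\<forall>b. trace_fragment ar b \<longrightarrow> lt ar \<gamma> c b = lt ar \<gamma> d b"
  shows "\<forall>z. maximal_trace ar z \<longrightarrow> tr ar \<gamma> c z = tr ar \<gamma> d z"
  \<comment> \<open>Truncations of a maximal trace respect the arities, so the two infima agree term
    by term.\<close>
  using assms by (simp add: tr_eq_INF_lt_truncate trace_fragment_truncate)

end
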